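(* Let $P=\{z\in\mathbb{R}^n: Az=b,\ Bz\leq d\}$ with $A\in\mathbb{Z}^{m_A\times n}$, $B\in\mathbb{Z}^{m_B\times n}$ be a polyhedron in $\mathbb{R}^n$. For all pairs of vertices $v^{(1)},v^{(2)}$ of $P$, the distances $\mathcal{CD}_f$, $\mathcal{CD}_{fb}$, $\mathcal{CD}_{fr}$, $\mathcal{CD}_{fbr}$ and $\mathcal{CD}$ between $v^{(1)}$ and $v^{(2)}$ are bounded above by $\mathcal{CD}_{fs}(v^{(1)},v^{(2)})$. Moreover, all these distances (including $\mathcal{CD}_{fs}$) are at most $\min\{n-\operatorname{rank}(A),\ \operatorname{rank}(A)-n+m_B\}$.
   Context: A circuit of $(A,B)$ is a vector $g\in\ker(A)\setminus\{0\}$ such that $Bg$ has inclusion-minimal support in $\{Bz: z\in\ker(A)\setminus\{0\}\}$, normalized to have coprime integer components. For vertices $v^{(1)},v^{(2)}$ of $P$, a circuit walk of length $k$ from $v^{(1)}$ to $v^{(2)}$ is a sequence $v^{(1)}=y^{(0)},\dots,y^{(k)}=v^{(2)}$ with $y^{(i+1)}-y^{(i)}=\alpha_i g^i$ for circuits $g^i$ and reals $\alpha_i>0$. Properties: (f) feasible: all $y^{(i)}\in P$; (r) non-repetitive: $g^i\neq g^j$ for $i\neq j$; (b) non-backwards: $g^j\neq -g^i$ for all $i,j$; (s) sign-compatible: $(Bg^i)_l(Bg^j)_l\geq0$ and $(Bg^i)_l(B(v^{(2)}-v^{(1)}))_l\geq0$ for all $i,j,l$. For a set $X$ of these letters, $\mathcal{CD}_X(v^{(1)},v^{(2)})$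 is the minimum length of a circuit walk from $v^{(1)}$ to $v^{(2)}$ with all properties in $X$; $\mathcal{CD}$ without subscript imposes no restriction. *)

theory Defs
  imports "HOL-Analysis.Analysis"
begin

abbreviation real_mat :: "int^'n^'m \<Rightarrow> real^'n^'m" where
  "real_mat \<equiv> map_matrix real_of_int"

text \<open>The order on vectors is componentwise.\<close>

definition polyh ::
  "int^'n^'mA \<Rightarrow> real^'mA \<Rightarrow> int^'n^'mB \<Rightarrow> real^'mB \<Rightarrow> (real^'n) set" where
  "polyh A b B d = {z. real_mat A *v z = b \<and> real_mat B *v z \<le> d}"

definition mat_ker :: "int^'n^'m \<Rightarrow> (real^'n) set" where
  "mat_ker A = {z. real_mat A *v z = 0}"

definition vsupp :: "real^'m \<Rightarrow> 'm set" where
  "vsupp x = {l. x $ l \<noteq> 0}"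

definition coprime_integral :: "real^'n \<Rightarrow> bool" where
  "coprime_integral g \<longleftrightarrow>
     (\<exists>h :: int^'n. (\<forall>l. g $ l = real_of_int (h $ l)) \<and> (GCD l. h $ l) = 1)"

definition circuit :: "int^'n^'mA \<Rightarrow> int^'n^'mB \<Rightarrow> real^'n \<Rightarrow> bool" where
  "circuit A B g \<longleftrightarrow>
     g \<in> mat_ker A - {0} \<and>
     \<not> (\<exists>z \<in> mat_ker A - {0}. vsupp (real_mat B *v z) \<subset> vsupp (real_mat B *v g)) \<and>
     coprime_integral g"

text \<open>
  A walk of length \<open>k\<close> has points \<open>y 0, \<dots>, y k\<close> and steps \<open>g i\<close>, \<open>\<alpha> i\<close> for \<open>i < k\<close>;
  values of these functions at larger arguments are irrelevant.
\<close>

definition circuit_walk ::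
  "int^'n^'mA \<Rightarrow> int^'n^'mB \<Rightarrow> real^'n \<Rightarrow> real^'n \<Rightarrow> nat \<Rightarrow>
   (nat \<Rightarrow> real^'n) \<Rightarrow> (nat \<Rightarrow> real^'n) \<Rightarrow> (nat \<Rightarrow> real) \<Rightarrow> bool" where
  "circuit_walk A B v1 v2 k y g \<alpha> \<longleftrightarrow>
     y 0 = v1 \<and> y k = v2 \<and>
     (\<forall>i<k. circuit A B (g i) \<and> \<alpha> i > 0 \<and> y (Suc i) - y i = \<alpha> i *\<^sub>R g i)"

datatype walk_prop = Feasible | NonRepetitive | NonBackwards | SignCompatible

fun has_prop ::
  "int^'n^'mA \<Rightarrow> real^'mA \<Rightarrow> int^'n^'mB \<Rightarrow> real^'mB \<Rightarrow> real^'n \<Rightarrow> real^'n \<Rightarrow> nat \<Rightarrow>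
   (nat \<Rightarrow> real^'n) \<Rightarrow> (nat \<Rightarrow> real^'n) \<Rightarrow> walk_prop \<Rightarrow> bool" where
  "has_prop A b B d v1 v2 k y g Feasible \<longleftrightarrow> (\<forall>i\<le>k. y i \<in> polyh A b B d)"
| "has_prop A b B d v1 v2 k y g NonRepetitive \<longleftrightarrow> (\<forall>i<k. \<forall>j<k. i \<noteq> j \<longrightarrow> g i \<noteq> g j)"
| "has_prop A b B d v1 v2 k y g NonBackwards \<longleftrightarrow> (\<forall>i<k. \<forall>j<k. g j \<noteq> - g i)"
| "has_prop A b B d v1 v2 k y g SignCompatible \<longleftrightarrow>
     (\<forall>i<k. \<forall>j<k. \<forall>l. (real_mat B *v g i) $ l * (real_mat B *v g j) $ l \<ge> 0) \<and>
     (\<forall>i<k. \<forall>l. (real_mat B *v g i) $ l * (real_mat B *v (v2 - v1)) $ l \<ge> 0)"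

text \<open>The infimum is attained when a walk exists, and is \<open>\<infinity>\<close> otherwise.\<close>

definition CD ::
  "int^'n^'mA \<Rightarrow> real^'mA \<Rightarrow> int^'n^'mB \<Rightarrow> real^'mB \<Rightarrow> walk_prop set \<Rightarrow>
   real^'n \<Rightarrow> real^'n \<Rightarrow> enat" where
  "CD A b B d X v1 v2 =
     Inf {enat k | k. \<exists>y g \<alpha>. circuit_walk A B v1 v2 k y g \<alpha> \<and>
                             (\<forall>p\<in>X. has_prop A b B d v1 v2 k y g p)}"

end

theory Submission
  imports Defs
begin

text \<open>
  Write \<open>u = v2 - v1\<close>. Since \<open>P\<close> has a vertex, \<open>B\<close> is injective on \<open>ker A\<close>, and \<open>u\<close> is a positive
  combination of circuits \<open>g\<close> for which \<open>B g\<close> is conformal to \<open>B u\<close>: subtract a multiple of such a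
  circuit that cancels a coordinate of \<open>B u\<close> and iterate. Every step lowers the dimension of
  \<open>D = {z \<in> ker A. supp (B z) \<subseteq> supp (B u)}\<close>, so at most \<open>dim D \<le> n - rank A\<close> circuits occur.
  The rows in \<open>supp (B u)\<close> that are tight at \<open>v1\<close> determine a vector of \<open>D\<close>, as do those tight at
  \<open>v2\<close>, and these two sets of rows are disjoint; with \<open>dim (ker A) \<le> dim D + (m\<^sub>B - |supp (B u)|)\<close> this
  gives \<open>dim D + dim (ker A) \<le> m\<^sub>B\<close>. Pairwise sign-compatible circuits with positive coefficients,
  taken in any order, form a feasible walk, so repeated circuits of a sign-compatible walk can be
  merged; sign-compatibility excludes backward steps.
\<close>

section \<open>Rank-nullity on a subspace\<close>

text \<open>On the orthogonal complement \<open>C\<close> of the kernel \<open>N\<close> within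
  \<open>S\<close>, the map \<open>f\<close> is injective and has the same image as on all of
  \<open>S\<close>, so the image has dimension \<open>dim S - dim N\<close>.\<close>

lemma dim_kernel_plus_dim_image:
  fixes f :: "'a::euclidean_space \<Rightarrow> 'b::euclidean_space"
  assumes S: "subspace S" and f: "linear f"
  shows "dim S = dim {x \<in> S. f x = 0} + dim (f ` S)"
proof -
  define N where "N = {x \<in> S. f x = 0}"
  define C where "C = {y \<in> S. \<forall>x\<in>N. orthogonal x y}"
  interpret linear f by (rule f)
  have N: "subspace N"
    unfolding N_def using S by (auto simp: subspace_def add scale)
  have C: "subspace C"
    unfolding C_def using S by (auto simp: subspace_def orthogonal_clauses)
  have dims: "dim C + dim N = dim S"
    unfolding C_def by (rule dim_subspace_orthogonal_to_vectors) (auto simp: N_def S N[unfolded N_def])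
  have "inj_on f C"
  proof (rule inj_onI)
    fix x y assume xy: "x \<in> C" "y \<in> C" "f x = f y"
    have "x - y \<in> C" using C xy by (simp add: subspace_diff)
    moreover have "x - y \<in> N" using xy S by (auto simp: N_def C_def diff subspace_diff)
    ultimately have "orthogonal (x - y) (x - y)" by (auto simp: C_def)
    then show "x = y" by (simp add: orthogonal_self)
  qed
  moreover have "span C = C" using C by (simp add: span_eq_iff)
  ultimately have "dim (f ` C) = dim C"
    by (intro dim_image_eq[OF f]) (simp only:)
  moreover have "f ` C = f ` S"
  proof
    show "f ` S \<subseteq> f ` C"
    proof
      fix w assume "w \<in> f ` S"
      then obtain s where s: "s \<in> S" "w = f s" by auto
      obtain y z where yz: "y \<in> span N" "\<And>w. w \<in> span N \<Longrightarrow> orthogonal z w" "s = y + z"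
        using orthogonal_subspace_decomp_exists[of N s] by blast
      have y: "y \<in> N" using yz(1) N by (metis span_eq_iff)
      have "z = s - y" using yz(3) by simp
      then have "z \<in> S" using s y S by (auto simp: N_def subspace_diff)
      then have "z \<in> C" using yz(2) by (auto simp: C_def span_base orthogonal_commute)
      moreover have "w = f z" using s yz(3) y by (simp add: N_def add)
      ultimately show "w \<in> f ` C" by blast
    qed
  qed (auto simp: C_def)
  ultimately show ?thesis using dims by (simp add: N_def)
qed

section \<open>From real to coprime integral vectors\<close>

text \<open>Over the rationals, the reals form a vector space in which \<open>{x}\<close> is
  independent, so a linear functional can be prescribed to be 1 at \<open>x\<close>. Linearity over
  the integers is what carries integral equations over to rational values.\<close>

lemma rational_linear_functional:
  fixes x :: real
  assumes "x \<noteq> 0"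
  obtains \<phi> :: "real \<Rightarrow> rat" where "\<And>a b. \<phi> (a + b) = \<phi> a + \<phi> b"
    "\<And>k a. \<phi> (of_int k * a) = of_int k * \<phi> a" "\<phi> x = 1"
proof -
  interpret vector_space_pair "\<lambda>q (x::real). of_rat q * x" "(*) :: rat \<Rightarrow> rat \<Rightarrow> rat"
    by unfold_locales (auto simp: of_rat_add of_rat_mult algebra_simps)
  have ind: "vs1.independent {x}"
    using assms vs1.independent_insert[of x "{}"] by (simp add: vs1.independent_empty)
  define \<phi> where "\<phi> = construct {x} (\<lambda>_. 1)"
  interpret lin: Vector_Spaces.linear "\<lambda>q (x::real). of_rat q * x" "(*) :: rat \<Rightarrow> rat \<Rightarrow> rat" \<phi>
    unfolding \<phi>_def by (rule linear_construct[OF ind])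
  show ?thesis
  proof
    show "\<phi> (a + b) = \<phi> a + \<phi> b" for a b by (rule lin.add)
    show "\<phi> (of_int k * a) = of_int k * \<phi> a" for k a
      using lin.scale[of "of_int k" a] by simp
    show "\<phi> x = 1" unfolding \<phi>_def by (simp add: construct_basis[OF ind])
  qed
qed

text \<open>Multiplying by the product \<open>D\<close> of all denominators gives integers, and
  dividing by their gcd \<open>c\<close> makes them coprime; hence \<open>r = D / c\<close>. The
  nonzero entry guarantees that \<open>c\<close> is not 0.\<close>

lemma rational_vector_coprime_multiple:
  fixes q :: "'n::finite \<Rightarrow> rat"
  assumes "q i \<noteq> 0"
  obtains r :: real where "r > 0" "coprime_integral (\<chi> j. r * of_rat (q j))"
proof -
  define D where "D = (\<Prod>j\<in>UNIV. snd (quotient_of (q j)))"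
  have dpos: "snd (quotient_of (q j)) > 0" for j
    by (rule quotient_of_denom_pos')
  have D: "D > 0" unfolding D_def by (intro prod_pos) (simp add: dpos)
  have "\<exists>m::int. of_int D * q j = of_int m" for j
  proof -
    have "snd (quotient_of (q j)) dvd D" unfolding D_def by (rule dvd_prodI) auto
    then obtain e where e: "D = snd (quotient_of (q j)) * e" by (elim dvdE)
    have "q j = of_int (fst (quotient_of (q j))) / of_int (snd (quotient_of (q j)))"
      by (rule quotient_of_div) simp
    then have "of_int D * q j = of_int (fst (quotient_of (q j)) * e)"
      using dpos[of j] e by (simp add: field_simps)
    then show ?thesis by blast
  qed
  then obtain m :: "'n \<Rightarrow> int" where m: "\<And>j. of_int D * q j = of_int (m j)" by metis
  define c where "c = Gcd (range m)"
  have "m i \<noteq> 0" using m[of i] assms D by auto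
  then have "c \<noteq> 0" unfolding c_def by auto
  moreover have "c \<ge> 0" unfolding c_def by simp
  ultimately have c: "c > 0" by simp
  define h where "h j = m j div c" for j
  have mh: "m j = c * h j" for j unfolding h_def c_def by simp
  have "c = Gcd ((*) c ` range h)"
    by (subst c_def) (simp add: image_image flip: mh)
  also have "\<dots> = c * Gcd (range h)"
    using c by (subst Gcd_mult) auto
  finally have g1: "Gcd (range h) = 1" using c by simp
  have eq: "of_int D / of_int c * of_rat (q j) = real_of_int (h j)" for j
  proof -
    have "real_of_rat (of_int D * q j) = of_rat (of_int (c * h j))" using m[of j] mh[of j] by simp
    then show ?thesis using c by (simp add: of_rat_mult field_simps)
  qed
  show ?thesis
  proof
    show "of_int D / of_int c > (0::real)" using D c by simp
    show "coprime_integral (\<chi> j. of_int D / of_int c * of_rat (q j))"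
      unfolding coprime_integral_def
      by (rule exI[of _ "\<chi> j. h j"]) (simp add: eq[simplified] g1)
  qed
qed

section \<open>Conformal vectors\<close>

text \<open>The support clause makes the relation transitive and makes any two vectors conformal to
  a common \<open>z\<close> sign-compatible with each other; a zero entry of \<open>z\<close> would
  otherwise allow opposite signs.\<close>

definition conformal :: "real^'m \<Rightarrow> real^'m \<Rightarrow> bool" where
  "conformal x y \<longleftrightarrow> (\<forall>l. 0 \<le> x $ l * y $ l \<and> (y $ l = 0 \<longrightarrow> x $ l = 0))"

lemma conformal_refl: "conformal x x"
  by (simp add: conformal_def)

lemma conformal_scaleR: "conformal x y \<Longrightarrow> 0 \<le> r \<Longrightarrow> conformal (r *\<^sub>R x) y"
  by (auto simp: conformal_def mult.assoc)

lemma conformal_trans: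
  assumes "conformal x y" "conformal y z" shows "conformal x z"
  unfolding conformal_def
proof (intro allI conjI impI)
  fix l
  have "0 \<le> x $ l * y $ l" "y $ l = 0 \<longrightarrow> x $ l = 0" "0 \<le> y $ l * z $ l" "z $ l = 0 \<longrightarrow> y $ l = 0"
    using assms by (auto simp: conformal_def)
  then show "0 \<le> x $ l * z $ l" "z $ l = 0 \<Longrightarrow> x $ l = 0"
    by (auto simp: zero_le_mult_iff)
qed

lemma conformal_sign_compatible:
  assumes "conformal x z" "conformal y z" shows "0 \<le> x $ l * y $ l"
proof -
  have "0 \<le> x $ l * z $ l" "z $ l = 0 \<longrightarrow> x $ l = 0" "0 \<le> y $ l * z $ l" "z $ l = 0 \<longrightarrow> y $ l = 0"
    using assms by (auto simp: conformal_def)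
  then show ?thesis by (auto simp: zero_le_mult_iff)
qed

text \<open>A ratio test: \<open>t\<close> is the least ratio of entries over the coordinates where
  \<open>x\<close> and \<open>w\<close> have the same strict sign. A coordinate attaining it becomes
  0 and none overshoots; all other coordinates do not move toward 0.\<close>

lemma conformal_reduction:
  fixes x w :: "real^'m"
  assumes supp: "vsupp w \<subseteq> vsupp x" and k: "0 < w $ k * x $ k"
  obtains t l where "0 < t" "conformal (x - t *\<^sub>R w) x" "l \<in> vsupp w" "l \<in> vsupp x" "(x - t *\<^sub>R w) $ l = 0"
proof -
  define S where "S = {l. 0 < w $ l * x $ l}"
  define t where "t = Min ((\<lambda>l. x $ l / w $ l) ` S)"
  have S: "finite S" "S \<noteq> {}" using k by (auto simp: S_def)
  have "t \<in> (\<lambda>l. x $ l / w $ l) ` S" unfolding t_def using S by (intro Min_in) auto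
  then obtain l where l: "l \<in> S" "t = x $ l / w $ l" by auto
  have le: "t \<le> x $ j / w $ j" if "j \<in> S" for j
    unfolding t_def using S that by (intro Min_le) auto
  have t: "0 < t" using l by (auto simp: S_def zero_less_mult_iff zero_less_divide_iff)
  have "conformal (x - t *\<^sub>R w) x" unfolding conformal_def
  proof (intro allI conjI impI)
    fix j
    show "0 \<le> (x - t *\<^sub>R w) $ j * x $ j"
    proof (cases "j \<in> S")
      case True
      then have "0 < w $ j * x $ j" by (simp add: S_def)
      then consider "0 < w $ j" "0 < x $ j" | "w $ j < 0" "x $ j < 0" by (auto simp: zero_less_mult_iff)
      then show ?thesis
        using le[OF True] by cases (auto simp: field_simps intro: mult_nonneg_nonneg mult_nonpos_nonpos)
    next
      case False
      then have "w $ j * x $ j \<le> 0" by (simp add: S_def)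
      then have "t * (w $ j * x $ j) \<le> 0" using t by (simp add: mult_le_0_iff)
      then show ?thesis by (simp add: algebra_simps) (smt (verit) zero_le_square)
    qed
    assume "x $ j = 0"
    then show "(x - t *\<^sub>R w) $ j = 0" using supp by (auto simp: vsupp_def)
  qed
  moreover have "w $ l \<noteq> 0" "x $ l \<noteq> 0" using l by (auto simp: S_def)
  ultimately show ?thesis using t l by (intro that[of t l]) (auto simp: vsupp_def)
qed

section \<open>Circuits from vectors of minimal support\<close>

lemma additive_sum_rat:
  fixes \<phi> :: "real \<Rightarrow> rat"
  assumes "\<And>a b. \<phi> (a + b) = \<phi> a + \<phi> b"
  shows "\<phi> (sum f S) = (\<Sum>x\<in>S. \<phi> (f x))"
proof -
  interpret additive \<phi> by standard (rule assms)
  show ?thesis by (rule sum)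
qed

lemma subspace_mat_ker: "subspace (mat_ker A)"
  by (auto simp: mat_ker_def subspace_def matrix_vector_right_distrib scaleR_matrix_vector_assoc[symmetric]
      matrix_vector_mult_scaleR)

text \<open>The system \<open>A z = 0\<close>, \<open>(B z)\<^sub>l = 0\<close> for \<open>l\<close> outside the support has integer coefficients, so
  a \<open>\<rat>\<close>-linear functional applied to the entries of \<open>z\<close> yields a rational solution;
  minimality makes the solution space one-dimensional.\<close>

lemma minimal_support_circuit:
  fixes A :: "int^'n^'mA" and B :: "int^'n^'mB"
  assumes triv: "mat_ker A \<inter> mat_ker B = {0}"
    and z: "z \<in> mat_ker A" "z \<noteq> 0"
    and min: "\<And>x. x \<in> mat_ker A \<Longrightarrow> vsupp (real_mat B *v x) \<subset> vsupp (real_mat B *v z) \<Longrightarrow> x = 0"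
  obtains r where "0 < r" "circuit A B (r *\<^sub>R z)"
proof -
  have inj: "x = 0" if "x \<in> mat_ker A" "real_mat B *v x = 0" for x
    using that triv by (auto simp: mat_ker_def)
  \<comment> \<open>Normalizing the functional at a nonzero entry of \<open>z\<close> makes the
    rational solution \<open>h\<close> nonzero.\<close>
  obtain i where i: "z $ i \<noteq> 0" using z by (auto simp: vec_eq_iff)
  obtain \<phi> :: "real \<Rightarrow> rat" where \<phi>: "\<And>a b. \<phi> (a + b) = \<phi> a + \<phi> b"
    "\<And>k a. \<phi> (of_int k * a) = of_int k * \<phi> a" "\<phi> (z $ i) = 1"
    using rational_linear_functional[OF i] by blast
  obtain c where c: "0 < c" "coprime_integral (\<chi> j. c * of_rat (\<phi> (z $ j)))"
    using rational_vector_coprime_multiple[of "\<lambda>j. \<phi> (z $ j)" i] \<phi>(3) by auto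
  define h :: "real^'n" where "h = (\<chi> j. c * of_rat (\<phi> (z $ j)))"
  \<comment> \<open>Used for the rows of \<open>A\<close> and for those rows of \<open>B\<close>
    that vanish on \<open>z\<close>.\<close>
  have row: "(\<Sum>j\<in>UNIV. real_of_int (a $ j) * h $ j) = 0"
    if "(\<Sum>j\<in>UNIV. real_of_int (a $ j) * z $ j) = 0" for a :: "int^'n"
  proof -
    have "\<phi> 0 = 0" using \<phi>(1)[of 0 0] by simp
    then have "(\<Sum>j\<in>UNIV. of_int (a $ j) * \<phi> (z $ j)) = 0"
      using arg_cong[OF that, of \<phi>] by (simp add: additive_sum_rat[OF \<phi>(1)] \<phi>(2))
    then have "(\<Sum>j\<in>UNIV. real_of_rat (of_int (a $ j) * \<phi> (z $ j))) = 0"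
      by (metis of_rat_sum of_rat_0)
    then have "c * (\<Sum>j\<in>UNIV. real_of_int (a $ j) * of_rat (\<phi> (z $ j))) = 0"
      by (simp add: of_rat_mult)
    then show ?thesis by (simp add: h_def sum_distrib_left algebra_simps)
  qed
  have hK: "h \<in> mat_ker A"
    using z(1) row by (auto simp: mat_ker_def matrix_vector_mult_def vec_eq_iff)
  have hsupp: "vsupp (real_mat B *v h) \<subseteq> vsupp (real_mat B *v z)"
    using row by (auto simp: vsupp_def matrix_vector_mult_def)
  have "h $ i \<noteq> 0" using c \<phi>(3) by (simp add: h_def)
  then have h0: "h \<noteq> 0" by auto
  then have "real_mat B *v h \<noteq> 0" using inj hK by blast
  then obtain l where l: "(real_mat B *v h) $ l \<noteq> 0" by (auto simp: vec_eq_iff)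
  then have zl: "(real_mat B *v z) $ l \<noteq> 0" using hsupp by (auto simp: vsupp_def)
  \<comment> \<open>Chosen to cancel coordinate \<open>l\<close>, so that
    \<open>z - s *\<^sub>R h\<close> has strictly smaller support and is 0 by minimality.\<close>
  define s where "s = (real_mat B *v z) $ l / (real_mat B *v h) $ l"
  have s0: "s \<noteq> 0" using l zl by (simp add: s_def)
  have B: "real_mat B *v (z - s *\<^sub>R h) = real_mat B *v z - s *\<^sub>R (real_mat B *v h)"
    by (simp add: matrix_vector_mult_diff_distrib matrix_vector_mult_scaleR)
  have "z - s *\<^sub>R h = 0"
  proof (rule min)
    show "z - s *\<^sub>R h \<in> mat_ker A"
      using z(1) hK by (intro subspace_diff subspace_scale subspace_mat_ker)
    have "l \<notin> vsupp (real_mat B *v (z - s *\<^sub>R h))" unfolding B vsupp_def using l by (simp add: s_def)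
    moreover have "vsupp (real_mat B *v (z - s *\<^sub>R h)) \<subseteq> vsupp (real_mat B *v z)"
      using hsupp by (auto simp: vsupp_def B)
    ultimately show "vsupp (real_mat B *v (z - s *\<^sub>R h)) \<subset> vsupp (real_mat B *v z)"
      using zl by (auto simp: vsupp_def)
  qed
  then have zs: "z = s *\<^sub>R h" by simp
  \<comment> \<open>The factor must be positive, so the sign of \<open>s\<close> is kept: the
    multiple of \<open>z\<close> is \<open>h\<close> or \<open>- h\<close>, and negation preserves
    coprimality.\<close>
  define r where "r = 1 / \<bar>s\<bar>"
  have rz: "r *\<^sub>R z = sgn s *\<^sub>R h" using s0 zs by (auto simp: r_def sgn_if)
  obtain m :: "int^'n" where m: "\<And>j. h $ j = real_of_int (m $ j)" "Gcd (range (($) m)) = 1"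
    using c(2) unfolding coprime_integral_def h_def[symmetric] by auto
  have "coprime_integral (sgn s *\<^sub>R h)"
  proof (cases "0 < s")
    case True
    then show ?thesis using c(2) by (simp add: h_def)
  next
    case False
    have "range (\<lambda>j. - m $ j) = (*) (- 1) ` range (($) m)" by auto
    then have "Gcd (range (\<lambda>j. - m $ j)) = Gcd (range (($) m))"
      by (simp only: Gcd_mult) simp
    then show ?thesis unfolding coprime_integral_def using False s0 m
      by (intro exI[of _ "- m"]) auto
  qed
  moreover have r: "0 < r" using s0 by (simp add: r_def)
  moreover have "vsupp (real_mat B *v (r *\<^sub>R z)) = vsupp (real_mat B *v z)"
    using r by (auto simp: vsupp_def matrix_vector_mult_scaleR)
  moreover have "r *\<^sub>R z \<in> mat_ker A" using z(1) by (intro subspace_scale subspace_mat_ker)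
  ultimately have "circuit A B (r *\<^sub>R z)"
    unfolding circuit_def using z(2) h0 s0 min by (auto simp: rz sgn_zero_iff)
  then show ?thesis using that r by blast
qed

text \<open>Take \<open>z\<close> of least support size among the nonzero kernel vectors conformal
  to \<open>u\<close>. Its support is then minimal among all nonzero kernel vectors: subtracting a
  multiple of some \<open>x\<close> of strictly smaller support, with suitable sign, would leave a
  nonzero conformal vector with fewer support elements.\<close>

lemma conformal_circuit_exists:
  fixes A :: "int^'n^'mA" and B :: "int^'n^'mB"
  assumes triv: "mat_ker A \<inter> mat_ker B = {0}"
    and u: "u \<in> mat_ker A" "u \<noteq> 0"
  obtains g where "circuit A B g" "conformal (real_mat B *v g) (real_mat B *v u)"
proof -
  have inj: "x = 0" if "x \<in> mat_ker A" "real_mat B *v x = 0" for x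
    using that triv by (auto simp: mat_ker_def)
  let ?P = "\<lambda>z. z \<in> mat_ker A \<and> z \<noteq> 0 \<and> conformal (real_mat B *v z) (real_mat B *v u)"
  obtain z where z: "?P z"
    and least: "\<And>x. ?P x \<Longrightarrow> card (vsupp (real_mat B *v z)) \<le> card (vsupp (real_mat B *v x))"
    using exists_least_iff[of "\<lambda>n. \<exists>z. ?P z \<and> card (vsupp (real_mat B *v z)) = n"] u conformal_refl
    by (metis not_le)
  have min: "x = 0"
    if x: "x \<in> mat_ker A" "vsupp (real_mat B *v x) \<subset> vsupp (real_mat B *v z)" for x
  proof (rule ccontr)
    assume "x \<noteq> 0"
    then obtain k where k: "(real_mat B *v x) $ k \<noteq> 0" using inj x by (auto simp: vec_eq_iff)
    \<comment> \<open>The sign makes \<open>w\<close> and \<open>z\<close> agree at row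
      \<open>k\<close>, as the ratio test requires.\<close>
    define w where "w = (if 0 < (real_mat B *v x) $ k * (real_mat B *v z) $ k then x else - x)"
    have Bw: "real_mat B *v w = real_mat B *v x \<or> real_mat B *v w = - (real_mat B *v x)"
      by (simp add: w_def vec.neg)
    then have wsupp: "vsupp (real_mat B *v w) = vsupp (real_mat B *v x)" by (auto simp: vsupp_def)
    have zk: "(real_mat B *v z) $ k \<noteq> 0" using k x by (auto simp: vsupp_def)
    have wk: "0 < (real_mat B *v w) $ k * (real_mat B *v z) $ k"
      using k zk by (auto simp: w_def vec.neg not_less less_le)
    obtain t l where t: "conformal (real_mat B *v z - t *\<^sub>R (real_mat B *v w)) (real_mat B *v z)"
      "l \<in> vsupp (real_mat B *v z)" "(real_mat B *v z - t *\<^sub>R (real_mat B *v w)) $ l = 0"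
      using conformal_reduction[OF _ wk] wsupp x by (metis psubset_imp_subset)
    define z' where "z' = z - t *\<^sub>R w"
    have Bz': "real_mat B *v z' = real_mat B *v z - t *\<^sub>R (real_mat B *v w)"
      by (simp add: z'_def matrix_vector_mult_diff_distrib matrix_vector_mult_scaleR)
    have "w \<in> mat_ker A" using x by (simp add: w_def subspace_neg subspace_mat_ker)
    then have K: "z' \<in> mat_ker A"
      unfolding z'_def using z by (intro subspace_diff subspace_scale subspace_mat_ker) auto
    \<comment> \<open>Row \<open>p\<close> is untouched by the subtraction, which keeps
      \<open>z'\<close> nonzero.\<close>
    obtain p where "p \<in> vsupp (real_mat B *v z)" "p \<notin> vsupp (real_mat B *v w)"
      using x wsupp by auto
    then have "(real_mat B *v z') $ p \<noteq> 0" by (simp add: Bz' vsupp_def)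
    then have "z' \<noteq> 0" by auto
    then have "?P z'" using K t(1) z conformal_trans by (auto simp: Bz')
    moreover have "vsupp (real_mat B *v z') \<subset> vsupp (real_mat B *v z)"
      using t unfolding Bz'[symmetric] by (auto simp: vsupp_def conformal_def)
    then have "card (vsupp (real_mat B *v z')) < card (vsupp (real_mat B *v z))"
      by (intro psubset_card_mono) auto
    ultimately show False using least by (meson not_le)
  qed
  obtain r where r: "0 < r" "circuit A B (r *\<^sub>R z)"
    using minimal_support_circuit[OF triv _ _ min] z by blast
  have "conformal (real_mat B *v (r *\<^sub>R z)) (real_mat B *v u)"
    using z r by (simp add: matrix_vector_mult_scaleR conformal_scaleR)
  with r show ?thesis using that by blast
qed

section \<open>Conformal decomposition into circuits\<close>

lemma subspace_support:
  "subspace {z \<in> mat_ker A. vsupp (real_mat B *v z) \<subseteq> S}"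
proof -
  have "{z \<in> mat_ker A. vsupp (real_mat B *v z) \<subseteq> S}
      = mat_ker A \<inter> {z. \<forall>l. l \<notin> S \<longrightarrow> (real_mat B *v z) $ l = 0}"
    by (auto simp: vsupp_def)
  moreover have "subspace {z. \<forall>l. l \<notin> S \<longrightarrow> (real_mat B *v z) $ l = 0}"
    by (auto simp: subspace_def matrix_vector_right_distrib matrix_vector_mult_scaleR)
  ultimately show ?thesis by (simp add: subspace_inter subspace_mat_ker)
qed

text \<open>Induction on the support size of \<open>B u\<close>: the ratio test removes a multiple
  of a conformal circuit \<open>c\<close>, and the remainder \<open>u'\<close> is decomposed by the
  induction hypothesis.\<close>

lemma conformal_decomposition:
  fixes A :: "int^'n^'mA" and B :: "int^'n^'mB"
  assumes triv: "mat_ker A \<inter> mat_ker B = {0}"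
    and u: "u \<in> mat_ker A"
  shows "\<exists>G \<beta>. finite G \<and> (\<forall>g\<in>G. circuit A B g \<and> 0 < \<beta> g \<and> conformal (real_mat B *v g) (real_mat B *v u))
     \<and> u = (\<Sum>g\<in>G. \<beta> g *\<^sub>R g) \<and> card G \<le> dim {z \<in> mat_ker A. vsupp (real_mat B *v z) \<subseteq> vsupp (real_mat B *v u)}"
  using u
proof (induction "card (vsupp (real_mat B *v u))" arbitrary: u rule: less_induct)
  case less
  have inj: "x = 0" if "x \<in> mat_ker A" "real_mat B *v x = 0" for x
    using that triv by (auto simp: mat_ker_def)
  show ?case
  proof (cases "u = 0")
    case True
    then show ?thesis by (intro exI[of _ "{}"]) auto
  next
    case False
    obtain c where c: "circuit A B c" "conformal (real_mat B *v c) (real_mat B *v u)"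
      using conformal_circuit_exists[OF triv less.prems False] by blast
    have cK: "c \<in> mat_ker A" "c \<noteq> 0" using c(1) by (auto simp: circuit_def)
    then obtain k where "(real_mat B *v c) $ k \<noteq> 0" using inj by (auto simp: vec_eq_iff)
    then have k: "0 < (real_mat B *v c) $ k * (real_mat B *v u) $ k"
      using c(2) by (simp add: conformal_def less_le) metis
    have supp: "vsupp (real_mat B *v c) \<subseteq> vsupp (real_mat B *v u)"
      using c(2) by (auto simp: conformal_def vsupp_def)
    obtain t l where t: "0 < t" "conformal (real_mat B *v u - t *\<^sub>R (real_mat B *v c)) (real_mat B *v u)"
      "l \<in> vsupp (real_mat B *v c)" "l \<in> vsupp (real_mat B *v u)"
      "(real_mat B *v u - t *\<^sub>R (real_mat B *v c)) $ l = 0"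
      using conformal_reduction[OF supp k] by blast
    define u' where "u' = u - t *\<^sub>R c"
    have Bu': "real_mat B *v u' = real_mat B *v u - t *\<^sub>R (real_mat B *v c)"
      by (simp add: u'_def matrix_vector_mult_diff_distrib matrix_vector_mult_scaleR)
    have K: "u' \<in> mat_ker A"
      unfolding u'_def using cK less.prems by (intro subspace_diff subspace_scale subspace_mat_ker)
    have conf: "conformal (real_mat B *v u') (real_mat B *v u)" using t(2) by (simp add: Bu')
    have l': "l \<notin> vsupp (real_mat B *v u')" using t(5) by (simp add: Bu' vsupp_def)
    have psub: "vsupp (real_mat B *v u') \<subset> vsupp (real_mat B *v u)"
      using conf l' t(4) by (auto simp: vsupp_def conformal_def)
    then have "card (vsupp (real_mat B *v u')) < card (vsupp (real_mat B *v u))"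
      by (intro psubset_card_mono) auto
    from less.hyps[OF this K] obtain G \<beta> where G: "finite G"
      "\<And>g. g \<in> G \<Longrightarrow> circuit A B g \<and> 0 < \<beta> g \<and> conformal (real_mat B *v g) (real_mat B *v u')"
      "u' = (\<Sum>g\<in>G. \<beta> g *\<^sub>R g)"
      "card G \<le> dim {z \<in> mat_ker A. vsupp (real_mat B *v z) \<subseteq> vsupp (real_mat B *v u')}"
      by blast
    \<comment> \<open>The circuits in \<open>G\<close> vanish at the cancelled row \<open>l\<close>,
      whereas \<open>c\<close> does not.\<close>
    have cG: "c \<notin> G" using G(2) l' t(3) by (auto simp: conformal_def vsupp_def)
    \<comment> \<open>The vector \<open>u\<close> lies only in the larger space, so the dimension
      drops by at least one, which pays for \<open>c\<close>.\<close>
    have "{z \<in> mat_ker A. vsupp (real_mat B *v z) \<subseteq> vsupp (real_mat B *v u')}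
        \<subset> {z \<in> mat_ker A. vsupp (real_mat B *v z) \<subseteq> vsupp (real_mat B *v u)}"
      using psub less.prems by auto
    then have "dim {z \<in> mat_ker A. vsupp (real_mat B *v z) \<subseteq> vsupp (real_mat B *v u')}
        < dim {z \<in> mat_ker A. vsupp (real_mat B *v z) \<subseteq> vsupp (real_mat B *v u)}"
      by (intro dim_psubset) (simp only: span_eq_iff[THEN iffD2, OF subspace_support])
    then have card: "card (insert c G)
        \<le> dim {z \<in> mat_ker A. vsupp (real_mat B *v z) \<subseteq> vsupp (real_mat B *v u)}"
      using G(1,4) cG by simp
    have "(\<Sum>g\<in>insert c G. (\<beta>(c := t)) g *\<^sub>R g) = t *\<^sub>R c + (\<Sum>g\<in>G. (\<beta>(c := t)) g *\<^sub>R g)"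
      using G(1) cG by simp
    also have "(\<Sum>g\<in>G. (\<beta>(c := t)) g *\<^sub>R g) = u'"
      unfolding G(3) using cG by (intro sum.cong) auto
    finally have sum: "u = (\<Sum>g\<in>insert c G. (\<beta>(c := t)) g *\<^sub>R g)" by (simp add: u'_def)
    have "\<forall>g\<in>insert c G. circuit A B g \<and> 0 < (\<beta>(c := t)) g \<and> conformal (real_mat B *v g) (real_mat B *v u)"
      using G(2) c t(1) cG conformal_trans[OF _ conf] by auto
    with card sum G(1) show ?thesis by blast
  qed
qed

section \<open>Tight rows at vertices and the dimension bound\<close>

text \<open>A nonzero \<open>z\<close> would keep \<open>v + e *\<^sub>R z\<close> and
  \<open>v - e *\<^sub>R z\<close> feasible for a small positive \<open>e\<close>, with
  \<open>v\<close> as their midpoint.\<close>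

lemma extreme_point_tight_injective:
  fixes A :: "int^'n^'mA" and B :: "int^'n^'mB"
  assumes v: "v extreme_point_of polyh A b B d" and z: "z \<in> mat_ker A"
    and tight: "\<And>l. (real_mat B *v v) $ l = d $ l \<Longrightarrow> (real_mat B *v z) $ l = 0"
  shows "z = 0"
proof (rule ccontr)
  assume "z \<noteq> 0"
  have vP: "real_mat A *v v = b" "\<And>l. (real_mat B *v v) $ l \<le> d $ l"
    using v by (auto simp: extreme_point_of_def polyh_def less_eq_vec_def)
  \<comment> \<open>A safe step length for row \<open>l\<close>. At tight rows \<open>z\<close>
    changes nothing, so any positive value works; elsewhere the added 1 avoids division by
    zero.\<close>
  define s where "s l = (if (real_mat B *v v) $ l = d $ l then 1
    else (d $ l - (real_mat B *v v) $ l) / (\<bar>(real_mat B *v z) $ l\<bar> + 1))" for l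
  have spos: "0 < s l" for l
    using vP(2)[of l] by (auto simp: s_def less_le intro!: divide_pos_pos)
  define e where "e = Min (range s)"
  have e: "0 < e" "e \<le> s l" for l using spos by (auto simp: e_def)
  have slack: "e * \<bar>(real_mat B *v z) $ l\<bar> \<le> d $ l - (real_mat B *v v) $ l" for l
  proof (cases "(real_mat B *v v) $ l = d $ l")
    case True
    then show ?thesis using tight by simp
  next
    case False
    have "e * (\<bar>(real_mat B *v z) $ l\<bar> + 1) \<le> d $ l - (real_mat B *v v) $ l"
      using e(2)[of l] False by (simp add: s_def field_simps)
    then show ?thesis using e(1) by (simp add: algebra_simps)
  qed
  have mem: "v + r *\<^sub>R z \<in> polyh A b B d" if "\<bar>r\<bar> = e" for r
  proof -
    have "r * (real_mat B *v z) $ l \<le> d $ l - (real_mat B *v v) $ l" for l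
      using slack[of l] that abs_ge_self[of "r * (real_mat B *v z) $ l"] by (simp add: abs_mult)
    then show ?thesis
      using z vP(1) by (auto simp: polyh_def mat_ker_def less_eq_vec_def matrix_vector_right_distrib
          matrix_vector_mult_scaleR algebra_simps)
  qed
  have "v + (- e) *\<^sub>R z \<in> polyh A b B d" "v + e *\<^sub>R z \<in> polyh A b B d"
    using mem[of "- e"] mem[of e] e(1) by auto
  moreover have "v \<in> open_segment (v + (- e) *\<^sub>R z) (v + e *\<^sub>R z)"
  proof -
    have "v = midpoint (v + (- e) *\<^sub>R z) (v + e *\<^sub>R z)"
      by (simp add: midpoint_def scaleR_2[symmetric])
    moreover have "v + (- e) *\<^sub>R z \<noteq> v + e *\<^sub>R z"
      using e(1) \<open>z \<noteq> 0\<close> by (auto simp: vec_eq_iff)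
    ultimately show ?thesis by (metis midpoint_in_open_segment)
  qed
  ultimately show False using v by (auto simp: extreme_point_of_def)
qed

text \<open>Each row in \<open>T\<close> imposes one linear equation: rank-nullity is applied to
  \<open>M\<close> with all entries outside \<open>T\<close> set to 0, whose image has dimension at
  most \<open>card T\<close>.\<close>

lemma dim_le_dim_coordinate_kernel:
  fixes M :: "real^'n^'m"
  assumes "subspace V"
  shows "dim V \<le> dim {z \<in> V. \<forall>l\<in>T. (M *v z) $ l = 0} + card T"
proof -
  define f :: "real^'n \<Rightarrow> real^'m" where "f z = (\<chi> l. if l \<in> T then (M *v z) $ l else 0)" for z
  have f: "linear f"
    by (rule linearI) (auto simp: f_def vec_eq_iff matrix_vector_right_distrib matrix_vector_mult_scaleR)
  have "dim (f ` V) \<le> dim {x::real^'m. \<forall>i. i \<notin> T \<longrightarrow> x $ i = 0}"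
    by (rule dim_subset) (auto simp: f_def)
  also have "\<dots> = card T"
    using dim_substandard_cart[of T, where 'a=real] by (simp add: dim_vec_eq)
  finally have "dim (f ` V) \<le> card T" .
  moreover have "{z \<in> V. f z = 0} = {z \<in> V. \<forall>l\<in>T. (M *v z) $ l = 0}"
    by (auto simp: f_def vec_eq_iff)
  ultimately show ?thesis using dim_kernel_plus_dim_image[OF assms f] by simp
qed

lemma dim_mat_ker:
  fixes A :: "int^'n^'mA"
  shows "dim (mat_ker A) + rank (real_mat A) = CARD('n)"
  using dim_kernel_plus_dim_image[of UNIV "\<lambda>x. real_mat A *v x"]
  by (simp add: mat_ker_def rank_dim_range)

text \<open>Two counts are added: \<open>2 * dim D \<le> card S\<close> from the disjoint sets of
  rows of \<open>S\<close> tight at the two vertices, and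
  \<open>dim (mat_ker A) \<le> dim D + card (- S)\<close> from the rows that cut out
  \<open>D\<close>.\<close>

lemma dim_support_space_le:
  fixes A :: "int^'n^'mA" and B :: "int^'n^'mB"
  assumes v1: "v1 extreme_point_of polyh A b B d" and v2: "v2 extreme_point_of polyh A b B d"
  defines "D \<equiv> {z \<in> mat_ker A. vsupp (real_mat B *v z) \<subseteq> vsupp (real_mat B *v (v2 - v1))}"
  shows "dim D + dim (mat_ker A) \<le> CARD('mB)"
proof -
  define S where "S = vsupp (real_mat B *v (v2 - v1))"
  define T where "T v = {l \<in> S. (real_mat B *v v) $ l = d $ l}" for v
  have D: "subspace D" unfolding D_def by (rule subspace_support)
  have dimT: "dim D \<le> card (T v)" if "v extreme_point_of polyh A b B d" for v
  proof -
    \<comment> \<open>Rows outside \<open>S\<close> vanish on all of \<open>D\<close>, so vanishing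
      on \<open>T v\<close> already means vanishing on every row tight at \<open>v\<close>.\<close>
    have "z = 0" if z: "z \<in> D" "\<forall>l\<in>T v. (real_mat B *v z) $ l = 0" for z
    proof (rule extreme_point_tight_injective[OF \<open>v extreme_point_of polyh A b B d\<close>])
      show "z \<in> mat_ker A" using z by (simp add: D_def)
      show "(real_mat B *v z) $ l = 0" if "(real_mat B *v v) $ l = d $ l" for l
        using z that by (cases "l \<in> S") (auto simp: D_def S_def T_def vsupp_def)
    qed
    then have "{z \<in> D. \<forall>l\<in>T v. (real_mat B *v z) $ l = 0} \<subseteq> {0}" by auto
    then have "dim {z \<in> D. \<forall>l\<in>T v. (real_mat B *v z) $ l = 0} \<le> dim {0 :: real^'n}"
      by (rule dim_subset)
    also have "\<dots> = 0" by simp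
    finally show ?thesis using dim_le_dim_coordinate_kernel[OF D, of "T v" "real_mat B"] by linarith
  qed
  have "D = {z \<in> mat_ker A. \<forall>l\<in>-S. (real_mat B *v z) $ l = 0}"
    by (auto simp: D_def S_def vsupp_def)
  then have ker: "dim (mat_ker A) \<le> dim D + card (- S)"
    using dim_le_dim_coordinate_kernel[OF subspace_mat_ker, of A "- S" "real_mat B"] by simp
  \<comment> \<open>A row tight at both vertices vanishes on \<open>v2 - v1\<close> and so is not in
    \<open>S\<close>.\<close>
  have "T v1 \<inter> T v2 = {}"
    by (auto simp: T_def S_def vsupp_def matrix_vector_mult_diff_distrib)
  then have "card (T v1) + card (T v2) = card (T v1 \<union> T v2)" by (simp add: card_Un_disjoint)
  also have "\<dots> \<le> card S" by (rule card_mono) (auto simp: T_def)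
  finally have "2 * dim D \<le> card S" using dimT[OF v1] dimT[OF v2] by simp
  moreover have "card S + card (- S) = CARD('mB)"
    using card_Un_disjoint[of S "- S"] by simp
  ultimately show ?thesis using ker by simp
qed

section \<open>Walks from sign-compatible sums\<close>

lemma matrix_vector_mult_sum_nth:
  fixes M :: "real^'n^'m"
  shows "(M *v (\<Sum>x\<in>S. c x *\<^sub>R x)) $ l = (\<Sum>x\<in>S. c x * (M *v x) $ l)"
  by (simp add: linear_sum[OF matrix_vector_mul_linear] matrix_vector_mult_scaleR)

text \<open>In each row all steps have the same weak sign, so the row value moves monotonically from
  \<open>v1\<close> to \<open>v2\<close> whatever the order of the circuits, and never exceeds the
  larger end value. An injective enumeration of \<open>G\<close> gives non-repetition.\<close>

lemma sign_compatible_sum_walk: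
  fixes A :: "int^'n^'mA" and B :: "int^'n^'mB"
  assumes triv: "mat_ker A \<inter> mat_ker B = {0}"
    and v1: "v1 \<in> polyh A b B d" and v2: "v2 \<in> polyh A b B d"
    and G: "finite G" "\<And>g. g \<in> G \<Longrightarrow> circuit A B g" "\<And>g. g \<in> G \<Longrightarrow> 0 < \<beta> g"
    and sign: "\<And>g h l. g \<in> G \<Longrightarrow> h \<in> G \<Longrightarrow> 0 \<le> (real_mat B *v g) $ l * (real_mat B *v h) $ l"
    and sum: "v2 - v1 = (\<Sum>g\<in>G. \<beta> g *\<^sub>R g)"
  shows "\<exists>y g \<alpha>. circuit_walk A B v1 v2 (card G) y g \<alpha> \<and> (\<forall>p. has_prop A b B d v1 v2 (card G) y g p)"
proof -
  have inj: "x = 0" if "x \<in> mat_ker A" "real_mat B *v x = 0" for x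
    using that triv by (auto simp: mat_ker_def)
  obtain e where e: "bij_betw e {0..<card G} G" using ex_bij_betw_nat_finite[OF G(1)] by blast
  have eG: "e i \<in> G" if "i < card G" for i using e that by (auto simp: bij_betw_def)
  have einj: "e i \<noteq> e j" if "i < card G" "j < card G" "i \<noteq> j" for i j
    using e that by (auto simp: bij_betw_def inj_on_def)
  define y where "y i = v1 + (\<Sum>g\<in>e ` {0..<i}. \<beta> g *\<^sub>R g)" for i
  have sub: "e ` {0..<i} \<subseteq> G" if "i \<le> card G" for i using eG that by auto
  have "y (card G) = v2" using e sum by (simp add: y_def bij_betw_def flip: sum)
  moreover have "y (Suc i) - y i = \<beta> (e i) *\<^sub>R e i" if "i < card G" for i
  proof -
    have "e i \<notin> e ` {0..<i}"
    proof
      assume "e i \<in> e ` {0..<i}"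
      then obtain j where "j < i" "e i = e j" by auto
      then show False using einj[of i j] that by auto
    qed
    then show ?thesis by (simp add: y_def atLeast0_lessThan_Suc)
  qed
  ultimately have walk: "circuit_walk A B v1 v2 (card G) y e (\<lambda>i. \<beta> (e i))"
    using G eG by (auto simp: circuit_walk_def y_def)
  have Bv: "(real_mat B *v v2) $ l = (real_mat B *v v1) $ l + (\<Sum>g\<in>G. \<beta> g * (real_mat B *v g) $ l)" for l
    using arg_cong[OF sum, of "\<lambda>x. (real_mat B *v x) $ l"]
    by (simp add: matrix_vector_mult_sum_nth matrix_vector_mult_diff_distrib)
  have feas: "y i \<in> polyh A b B d" if i: "i \<le> card G" for i
  proof -
    have "(\<Sum>g\<in>e ` {0..<i}. \<beta> g *\<^sub>R g) \<in> mat_ker A"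
      using sub[OF i] G(2) by (intro subspace_sum subspace_scale subspace_mat_ker) (auto simp: circuit_def)
    then have "real_mat A *v y i = b"
      using v1 by (simp add: y_def polyh_def mat_ker_def matrix_vector_right_distrib)
    moreover have "(real_mat B *v y i) $ l \<le> d $ l" for l
    proof -
      have Bd: "(real_mat B *v v1) $ l \<le> d $ l" "(real_mat B *v v2) $ l \<le> d $ l"
        using v1 v2 by (auto simp: polyh_def less_eq_vec_def)
      have By: "(real_mat B *v y i) $ l = (real_mat B *v v1) $ l
          + (\<Sum>g\<in>e ` {0..<i}. \<beta> g * (real_mat B *v g) $ l)"
        by (simp add: y_def matrix_vector_right_distrib matrix_vector_mult_sum_nth)
      show ?thesis
      \<comment> \<open>One positive step makes row \<open>l\<close> nondecreasing, hence bounded by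
        its value at \<open>v2\<close>; otherwise it is nonincreasing and bounded by its value at
        \<open>v1\<close>.\<close>
      proof (cases "\<exists>h\<in>G. 0 < (real_mat B *v h) $ l")
        case True
        then obtain h where h: "h \<in> G" "0 < (real_mat B *v h) $ l" by blast
        have "0 \<le> \<beta> g * (real_mat B *v g) $ l" if "g \<in> G" for g
          using sign[OF that h(1), of l] h(2) G(3)[OF that] by (simp add: zero_le_mult_iff)
        then have "(\<Sum>g\<in>e ` {0..<i}. \<beta> g * (real_mat B *v g) $ l) \<le> (\<Sum>g\<in>G. \<beta> g * (real_mat B *v g) $ l)"
          using sub[OF i] G(1) by (intro sum_mono2) auto
        then show ?thesis using By Bv[of l] Bd by simp
      next
        case False
        have "\<beta> g * (real_mat B *v g) $ l \<le> 0" if "g \<in> e ` {0..<i}" for g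
        proof -
          have "g \<in> G" using that sub[OF i] by auto
          then have "0 < \<beta> g" "(real_mat B *v g) $ l \<le> 0" using False G(3) by force+
          then show ?thesis by (simp add: mult_le_0_iff)
        qed
        then have "(\<Sum>g\<in>e ` {0..<i}. \<beta> g * (real_mat B *v g) $ l) \<le> 0" by (rule sum_nonpos)
        then show ?thesis using By Bd by simp
      qed
    qed
    ultimately show ?thesis by (simp add: polyh_def less_eq_vec_def)
  qed
  \<comment> \<open>Opposite circuits would give a negated square that is nonnegative in every row,
    so \<open>B\<close> would annihilate a nonzero kernel vector of \<open>A\<close>.\<close>
  have nonback: "e j \<noteq> - e i" if ij: "i < card G" "j < card G" for i j
  proof
    assume eq: "e j = - e i"
    have "(real_mat B *v e i) $ l = 0" for l
      using sign[OF eG[OF ij(1)] eG[OF ij(2)], of l] by (simp add: eq vec.neg) (smt (verit) not_real_square_gt_zero)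
    then have "real_mat B *v e i = 0" by (simp add: vec_eq_iff)
    then show False using inj[of "e i"] G(2)[OF eG[OF ij(1)]] by (auto simp: circuit_def)
  qed
  \<comment> \<open>The difference \<open>v2 - v1\<close> is a positive combination of
    \<open>G\<close>, so pairwise sign-compatibility carries over to it.\<close>
  have signu: "0 \<le> (real_mat B *v g) $ l * (real_mat B *v (v2 - v1)) $ l" if "g \<in> G" for g l
  proof -
    have "(real_mat B *v g) $ l * (real_mat B *v (v2 - v1)) $ l
        = (\<Sum>h\<in>G. \<beta> h * ((real_mat B *v g) $ l * (real_mat B *v h) $ l))"
      unfolding sum matrix_vector_mult_sum_nth sum_distrib_left by (simp add: mult_ac)
    also have "\<dots> \<ge> 0" by (intro sum_nonneg mult_nonneg_nonneg[OF less_imp_le[OF G(3)] sign] that)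
    finally show ?thesis .
  qed
  have "has_prop A b B d v1 v2 (card G) y e p" for p
    using feas einj nonback sign eG signu by (cases p) auto
  with walk show ?thesis by blast
qed

section \<open>Comparison of the distances\<close>

lemma CD_le:
  assumes "circuit_walk A B v1 v2 k y g \<alpha>" "\<And>p. p \<in> X \<Longrightarrow> has_prop A b B d v1 v2 k y g p"
  shows "CD A b B d X v1 v2 \<le> enat k"
  unfolding CD_def using assms by (intro Inf_lower) blast

lemma CD_antimono: "X \<subseteq> Y \<Longrightarrow> CD A b B d X v1 v2 \<le> CD A b B d Y v1 v2"
  unfolding CD_def by (rule Inf_superset_mono) blast

text \<open>Merging equal circuits of a sign-compatible walk leaves pairwise sign-compatible
  distinct circuits, which give a walk with all four properties and no more steps. If no such walk
  exists, the right side is infinite.\<close>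

lemma CD_UNIV_le_sign_compatible:
  fixes A :: "int^'n^'mA" and B :: "int^'n^'mB"
  assumes triv: "mat_ker A \<inter> mat_ker B = {0}"
    and v1: "v1 \<in> polyh A b B d" and v2: "v2 \<in> polyh A b B d"
  shows "CD A b B d UNIV v1 v2 \<le> CD A b B d {Feasible, SignCompatible} v1 v2"
  unfolding CD_def[of _ _ _ _ "{Feasible, SignCompatible}"]
proof (rule Inf_greatest)
  fix n assume "n \<in> {enat k |k. \<exists>y g \<alpha>. circuit_walk A B v1 v2 k y g \<alpha> \<and>
    (\<forall>p\<in>{Feasible, SignCompatible}. has_prop A b B d v1 v2 k y g p)}"
  then obtain k y g \<alpha> where n: "n = enat k" and w: "circuit_walk A B v1 v2 k y g \<alpha>"
    and s: "has_prop A b B d v1 v2 k y g SignCompatible" by auto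
  define G where "G = g ` {..<k}"
  \<comment> \<open>The total step length spent on \<open>c\<close>, positive because each
    \<open>c\<close> in \<open>G\<close> is used at least once.\<close>
  define \<beta> where "\<beta> c = (\<Sum>i | i < k \<and> g i = c. \<alpha> i)" for c
  have "v2 - v1 = (\<Sum>i<k. y (Suc i) - y i)"
    using w sum_lessThan_telescope[of y k] by (simp add: circuit_walk_def)
  also have "\<dots> = (\<Sum>i<k. \<alpha> i *\<^sub>R g i)"
    using w by (intro sum.cong) (auto simp: circuit_walk_def)
  also have "\<dots> = (\<Sum>c\<in>G. \<Sum>i | i \<in> {..<k} \<and> g i = c. \<alpha> i *\<^sub>R g i)"
    unfolding G_def by (rule sum.image_gen) simp
  also have "\<dots> = (\<Sum>c\<in>G. \<beta> c *\<^sub>R c)"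
    by (intro sum.cong) (auto simp: \<beta>_def scaleR_sum_left)
  finally have sum: "v2 - v1 = (\<Sum>c\<in>G. \<beta> c *\<^sub>R c)" .
  have pos: "0 < \<beta> c" if "c \<in> G" for c
    unfolding \<beta>_def using that w by (intro sum_pos) (auto simp: G_def circuit_walk_def)
  have "\<exists>y g \<alpha>. circuit_walk A B v1 v2 (card G) y g \<alpha> \<and> (\<forall>p. has_prop A b B d v1 v2 (card G) y g p)"
    using w s by (intro sign_compatible_sum_walk[OF triv v1 v2 _ _ pos _ sum])
      (auto simp: G_def circuit_walk_def)
  then have "CD A b B d UNIV v1 v2 \<le> enat (card G)" using CD_le by blast
  also have "card G \<le> k" unfolding G_def using card_image_le[of "{..<k}" g] by simp
  finally show "CD A b B d UNIV v1 v2 \<le> n" by (simp add: n)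
qed

theorem theorem2:
  fixes A :: "int^'n^'mA" and b :: "real^'mA"
    and B :: "int^'n^'mB" and d :: "real^'mB"
    and v1 v2 :: "real^'n"
  assumes "v1 extreme_point_of polyh A b B d"
    and "v2 extreme_point_of polyh A b B d"
  shows "(\<forall>X \<in> {{Feasible}, {Feasible, NonBackwards}, {Feasible, NonRepetitive},
                 {Feasible, NonBackwards, NonRepetitive}, {}}.
            CD A b B d X v1 v2 \<le> CD A b B d {Feasible, SignCompatible} v1 v2) \<and>
         (\<forall>X \<in> {{Feasible}, {Feasible, NonBackwards}, {Feasible, NonRepetitive},
                 {Feasible, NonBackwards, NonRepetitive}, {}, {Feasible, SignCompatible}}.
            ereal_of_enat (CD A b B d X v1 v2) \<le>
              ereal (min (real CARD('n) - real (rank (real_mat A)))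
                         (real (rank (real_mat A)) - real CARD('n) + real CARD('mB))))"
proof -
  have "x = 0" if "x \<in> mat_ker A" "real_mat B *v x = 0" for x
    using extreme_point_tight_injective[OF assms(1) that(1)] that(2) by simp
  then have triv: "mat_ker A \<inter> mat_ker B = {0}" by (auto simp: mat_ker_def)
  have P: "v1 \<in> polyh A b B d" "v2 \<in> polyh A b B d"
    using assms by (auto simp: extreme_point_of_def)
  then have u: "v2 - v1 \<in> mat_ker A"
    by (auto simp: polyh_def mat_ker_def matrix_vector_mult_diff_distrib)
  obtain G \<beta> where G: "finite G"
    "\<forall>g\<in>G. circuit A B g \<and> 0 < \<beta> g \<and> conformal (real_mat B *v g) (real_mat B *v (v2 - v1))"
    "v2 - v1 = (\<Sum>g\<in>G. \<beta> g *\<^sub>R g)"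
    and card: "card G \<le> dim {z \<in> mat_ker A. vsupp (real_mat B *v z) \<subseteq> vsupp (real_mat B *v (v2 - v1))}"
      (is "_ \<le> dim ?D")
    using conformal_decomposition[OF triv u] by (elim exE conjE) (rule that)
  \<comment> \<open>A single walk with all four properties bounds every distance at once.\<close>
  have "\<exists>y g \<alpha>. circuit_walk A B v1 v2 (card G) y g \<alpha> \<and> (\<forall>p. has_prop A b B d v1 v2 (card G) y g p)"
  proof (rule sign_compatible_sum_walk[OF triv P G(1) _ _ _ G(3)])
    fix g h l assume "g \<in> G" "h \<in> G"
    then show "0 \<le> (real_mat B *v g) $ l * (real_mat B *v h) $ l"
      using G(2) by (intro conformal_sign_compatible) auto
  qed (use G(2) in auto)
  then have UNIV: "CD A b B d UNIV v1 v2 \<le> enat (card G)" using CD_le by blast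
  \<comment> \<open>This inclusion yields the bound by \<open>n - rank A\<close>; the vertex count
    yields the other term of the minimum.\<close>
  have "dim ?D \<le> dim (mat_ker A)" by (rule dim_subset) auto
  then have "real (card G) \<le> min (real CARD('n) - real (rank (real_mat A)))
      (real (rank (real_mat A)) - real CARD('n) + real CARD('mB))"
    using card dim_support_space_le[OF assms] dim_mat_ker[of A] by linarith
  then have card': "ereal_of_enat (enat (card G)) \<le> ereal (min (real CARD('n) - real (rank (real_mat A)))
      (real (rank (real_mat A)) - real CARD('n) + real CARD('mB)))" by simp
  have "CD A b B d X v1 v2 \<le> enat (card G)" for X
    using CD_antimono[OF subset_UNIV] UNIV by (rule order_trans)
  then have bound: "ereal_of_enat (CD A b B d X v1 v2) \<le> ereal (min (real CARD('n) - real (rank (real_mat A)))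
      (real (rank (real_mat A)) - real CARD('n) + real CARD('mB)))" for X
    by (intro order_trans[OF _ card']) (simp only: ereal_of_enat_le_iff)
  \<comment> \<open>The distance requiring all four properties lies between the two sides.\<close>
  have "CD A b B d X v1 v2 \<le> CD A b B d {Feasible, SignCompatible} v1 v2" for X
    using CD_antimono[OF subset_UNIV] CD_UNIV_le_sign_compatible[OF triv P] by (rule order_trans)
  then show ?thesis using bound by blast
qed

end
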